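(* Let $K=\mathbb{C}\{\!\{t\}\!\}$ and let $I=\langle f_1,\dots,f_N\rangle\subset K[x_1,\dots,x_N]$ be the equilibrium ideal of a multilinear network game. Let $v\in\operatorname{Trop}(V(I))$ be a valuation vector, and let $$J_v:=\langle \operatorname{in}_v(f_1),\dots,\operatorname{in}_v(f_N)\rangle\subset\mathbb{C}[x_1,\dots,x_N]$$ be the generator-wise initial system. Assume that: (i) $v$ is generator-wise generic, meaning that each $\operatorname{in}_v(f_i)$ contains exactly two monomials; (ii) after ordering rows and columns according to the strongly connected components of the exponent-difference graph associated with $J_v$, each diagonal block $B_r$ (of size $m_r\times m_r$) of the exponent-difference matrix $A_v$ is unimodular, i.e. $B_r\in GL_{m_r}(\mathbb{Z})$. Then $V(J_v)\subset(\mathbb{C}^* )^N$ consists of a single point. Consequently, all Puiseux equilibrium branches with valuation $v$ (points $x(t)\in V(I)\subset (K^* )^N$ with $\operatorname{val}(x(t))=v$) share the same leading coefficient vector.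
   Context: $K=\mathbb{C}\{\!\{t\}\!\}$ is the field of Puiseux series with its usual valuation $\operatorname{val}:K^*\to\mathbb{R}$ (lowest exponent of $t$ with nonzero coefficient). For $a\in K^*$, its leading coefficient is the (nonzero complex) coefficient of $t^{\operatorname{val}(a)}$. For $x\in(K^* )^N$, $\operatorname{val}(x)=(\operatorname{val}(x_1),\dots,\operatorname{val}(x_N))$, and the leading coefficient vector of $x$ is the vector in $(\mathbb{C}^* )^N$ of leading coefficients of the coordinates. Multilinear network game: the equilibrium (indifference) polynomials are of the form $f_i=\sum_{S\subseteq[N]\setminus\{i\}}c_{i,S}\prod_{j\in S}x_j$ with $c_{i,S}\in K$, $i=1,\dots,N$; the equilibrium ideal is $I=\langle f_1,\dots,f_N\rangle$, and $V(I)$ denotes its zero set in $(K^* )^N$. A point of $V(I)\subset(K^* )^N$ is called a Puiseux equilibrium branch. Initial forms: for nonzero $f=\sum_\alpha c_\alpha x^\alpha\in K[x_1,\dots,x_N]$ and $v\in\mathbb{R}^N$, $\operatorname{in}_v(f)\in\mathbb{C}[x_1,\dots,x_N]$ is the sum of the terms $\operatorname{lc}(c_\alpha)x^\alpha$ over those $\alpha$ (with $c_\alpha\ne0$) at which $\operatorname{val}(c_\alpha)+\alpha\cdot v$ attains its minimum, where $\operatorname{lc}$ denotes the leading coefficient. $\operatorname{in}_v(I)$ is the ideal generated by all $\operatorname{in}_v(f)$, $f\in I$, and $\operatorname{Trop}(V(I))=\{v\in\mathbb{R}^N:\operatorname{in}_v(I)\text{ contains no monomial}\}$. $V(J_v)$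 denotes the zero set of $J_v$ in $(\mathbb{C}^* )^N$. When each $\operatorname{in}_v(f_i)=c_{i,1}x^{\alpha_i}-c_{i,2}x^{\beta_i}$ with $c_{i,1},c_{i,2}\in\mathbb{C}^*$ and $\alpha_i\neq\beta_i\in\{0,1\}^N$, the exponent-difference matrix is the matrix $A_v\in\mathbb{Z}^{N\times N}$ whose $i$-th row is $\alpha_i-\beta_i$. The exponent-difference graph is the directed graph on $\{1,\dots,N\}$ with an edge $i\to j$ whenever $(A_v)_{ij}\neq0$. Ordering its strongly connected components topologically (edges between distinct components go from earlier to later ones) and permuting rows and columns of $A_v$ simultaneously makes $A_v$ block upper triangular; the diagonal blocks $B_r$ are the square submatrices with rows and columns indexed by a single strongly connected component. *)

theory Defs
  imports
    "HOL-Analysis.Analysis"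
    "HOL-Computational_Algebra.Formal_Laurent_Series"
    "HOL-Library.Poly_Mapping"
    "Graph_Theory.Digraph_Component"
begin

no_notation fps_nth (infixl "$" 75)

lemma fls_compose_power_compose:
  assumes "m > 0" "n > 0"
  shows "fls_compose_power (fls_compose_power f m) n = fls_compose_power f (m * n)"
proof (rule fls_eqI)
  fix k :: int
  show "fls_nth (fls_compose_power (fls_compose_power f m) n) k =
        fls_nth (fls_compose_power f (m * n)) k"
  proof (cases "int n dvd k")
    case True
    then obtain l where "k = int n * l" by blast
    then show ?thesis using assms by (simp add: fls_nth_compose_power mult.commute)
  next
    case False
    then have "\<not> int (m * n) dvd k" by (metis dvd_mult_right of_nat_mult)
    then show ?thesis using False assms by (simp add: fls_nth_compose_power)
  qed
qed

lemma fls_compose_power_commute: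
  assumes "m > 0" "n > 0"
  shows "fls_compose_power (fls_compose_power f m) n = fls_compose_power (fls_compose_power f n) m"
  using assms by (simp add: fls_compose_power_compose mult.commute)

lemma fls_compose_power_inject:
  assumes "n > 0" "fls_compose_power f n = fls_compose_power g n"
  shows "f = g"
proof (rule fls_eqI)
  fix k :: int
  have "fls_nth (fls_compose_power f n) (int n * k) = fls_nth (fls_compose_power g n) (int n * k)"
    by (simp add: assms(2))
  then show "fls_nth f k = fls_nth g k" using assms(1) by (simp add: fls_nth_compose_power)
qed

lemma fls_compose_power_inverse:
  fixes f :: "'a :: field fls"
  assumes "n > 0"
  shows "fls_compose_power (inverse f) n = inverse (fls_compose_power f n)"
proof (cases "f = 0")
  case False
  have "fls_compose_power (inverse f) n * fls_compose_power f n = fls_compose_power (inverse f * f) n"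
    by simp
  also have "\<dots> = 1" using False assms by simp
  finally show ?thesis by (metis inverse_inverse_eq inverse_unique)
qed simp

lemma fls_compose_power_common_add:
  fixes f f' g g' :: "'a :: field fls"
  assumes pos: "m > 0" "m' > 0" "n > 0" "n' > 0"
    and f: "fls_compose_power f m' = fls_compose_power f' m"
    and g: "fls_compose_power g n' = fls_compose_power g' n"
  shows "fls_compose_power (fls_compose_power f n + fls_compose_power g m) (m' * n') =
         fls_compose_power (fls_compose_power f' n' + fls_compose_power g' m') (m * n)"
proof -
  have "fls_compose_power f (n * (m' * n')) = fls_compose_power (fls_compose_power f m') (n * n')"
    using pos by (simp add: fls_compose_power_compose mult_ac)
  also have "\<dots> = fls_compose_power f' (n' * (m * n))"
    using pos by (simp add: f fls_compose_power_compose mult_ac)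
  finally have 1: "fls_compose_power f (n * (m' * n')) = fls_compose_power f' (n' * (m * n))" .
  have "fls_compose_power g (m * (m' * n')) = fls_compose_power (fls_compose_power g n') (m * m')"
    using pos by (simp add: fls_compose_power_compose mult_ac)
  also have "\<dots> = fls_compose_power g' (m' * (m * n))"
    using pos by (simp add: g fls_compose_power_compose mult_ac)
  finally have 2: "fls_compose_power g (m * (m' * n')) = fls_compose_power g' (m' * (m * n))" .
  show ?thesis
    using pos by (simp add: fls_compose_power_compose 1 2)
qed

lemma fls_compose_power_common_mult:
  fixes f f' g g' :: "'a :: field fls"
  assumes pos: "m > 0" "m' > 0" "n > 0" "n' > 0"
    and f: "fls_compose_power f m' = fls_compose_power f' m"
    and g: "fls_compose_power g n' = fls_compose_power g' n"
  shows "fls_compose_power (fls_compose_power f n * fls_compose_power g m) (m' * n') =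
         fls_compose_power (fls_compose_power f' n' * fls_compose_power g' m') (m * n)"
proof -
  have "fls_compose_power f (n * (m' * n')) = fls_compose_power (fls_compose_power f m') (n * n')"
    using pos by (simp add: fls_compose_power_compose mult_ac)
  also have "\<dots> = fls_compose_power f' (n' * (m * n))"
    using pos by (simp add: f fls_compose_power_compose mult_ac)
  finally have 1: "fls_compose_power f (n * (m' * n')) = fls_compose_power f' (n' * (m * n))" .
  have "fls_compose_power g (m * (m' * n')) = fls_compose_power (fls_compose_power g n') (m * m')"
    using pos by (simp add: fls_compose_power_compose mult_ac)
  also have "\<dots> = fls_compose_power g' (m' * (m * n))"
    using pos by (simp add: g fls_compose_power_compose mult_ac)
  finally have 2: "fls_compose_power g (m * (m' * n')) = fls_compose_power g' (m' * (m * n))" .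
  show ?thesis
    using pos by (simp add: fls_compose_power_compose 1 2)
qed

lemma fls_subdegree_compose_power:
  assumes "n > 0"
  shows "fls_subdegree (fls_compose_power f n) = int n * fls_subdegree f"
proof (cases "f = 0")
  case False
  show ?thesis
  proof (rule fls_subdegree_eqI)
    show "fls_nth (fls_compose_power f n) (int n * fls_subdegree f) \<noteq> 0"
      using False assms by (simp add: fls_nth_compose_power)
    fix k assume "k < int n * fls_subdegree f"
    then show "fls_nth (fls_compose_power f n) k = 0"
      using assms by (auto simp: fls_nth_compose_power elim!: dvdE)
  qed
qed simp

text \<open>
  The union of the fields of Laurent series in \<open>t\<^sup>1\<^sup>/\<^sup>n\<close>, \<open>n \<ge> 1\<close>: the pair \<open>(n, f)\<close>
  represents \<open>f(t\<^sup>1\<^sup>/\<^sup>n)\<close>. Pairs \<open>(m, f)\<close> and \<open>(n, g)\<close> represent the same series iff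
  \<open>f(s\<^sup>n) = g(s\<^sup>m)\<close>, where \<open>s\<close> stands for the \<open>mn\<close>-th root of \<open>t\<close>.
\<close>

definition puiseux_rel :: "nat \<times> 'a::field fls \<Rightarrow> nat \<times> 'a fls \<Rightarrow> bool" where
  "puiseux_rel = (\<lambda>(m, f) (n, g).
     m > 0 \<and> n > 0 \<and> fls_compose_power f n = fls_compose_power g m)"

lemma puiseux_rel_part_equivp:
  "part_equivp (puiseux_rel :: nat \<times> 'a::field fls \<Rightarrow> _)"
proof (rule part_equivpI)
  show "\<exists>x. puiseux_rel x x"
    by (rule exI[of _ "(1, 0)"]) (simp add: puiseux_rel_def)
  show "symp puiseux_rel"
    by (auto simp: symp_def puiseux_rel_def)
  have "puiseux_rel (m, f) (k, h)"
    if "puiseux_rel (m, f) (n, g)" "puiseux_rel (n, g) (k, h)" for m n k and f g h :: "'a fls"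
  proof -
    have pos: "m > 0" "n > 0" "k > 0"
      and fg: "fls_compose_power f n = fls_compose_power g m"
      and gh: "fls_compose_power g k = fls_compose_power h n"
      using that by (auto simp: puiseux_rel_def)
    have "fls_compose_power (fls_compose_power f k) n = fls_compose_power (fls_compose_power h m) n"
      using pos fg gh by (metis fls_compose_power_commute)
    then have "fls_compose_power f k = fls_compose_power h m"
      by (rule fls_compose_power_inject[OF pos(2)])
    then show ?thesis
      using pos by (simp add: puiseux_rel_def)
  qed
  then show "transp (puiseux_rel :: _ \<times> 'a fls \<Rightarrow> _)"
    by (auto simp: transp_def)
qed

quotient_type (overloaded) 'a puiseux = "nat \<times> 'a::field fls" / partial: puiseux_rel
  by (rule puiseux_rel_part_equivp)

instantiation puiseux :: (field) field
begin

lift_definition zero_puiseux :: "'a puiseux" is "(1, 0)"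
  by (simp add: puiseux_rel_def)

lift_definition one_puiseux :: "'a puiseux" is "(1, 1)"
  by (simp add: puiseux_rel_def)

lift_definition plus_puiseux :: "'a puiseux \<Rightarrow> 'a puiseux \<Rightarrow> 'a puiseux" is
  "\<lambda>(m, f) (n, g). (m * n, fls_compose_power f n + fls_compose_power g m)"
  by (auto simp: puiseux_rel_def simp del: fls_compose_power_add intro!: fls_compose_power_common_add)

lift_definition times_puiseux :: "'a puiseux \<Rightarrow> 'a puiseux \<Rightarrow> 'a puiseux" is
  "\<lambda>(m, f) (n, g). (m * n, fls_compose_power f n * fls_compose_power g m)"
  by (auto simp: puiseux_rel_def simp del: fls_compose_power_mult intro!: fls_compose_power_common_mult)

lift_definition uminus_puiseux :: "'a puiseux \<Rightarrow> 'a puiseux" is "\<lambda>(n, f). (n, - f)"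
  by (auto simp: puiseux_rel_def)

lift_definition inverse_puiseux :: "'a puiseux \<Rightarrow> 'a puiseux" is "\<lambda>(n, f). (n, inverse f)"
  by (auto simp: puiseux_rel_def fls_compose_power_inverse)

definition minus_puiseux :: "'a puiseux \<Rightarrow> 'a puiseux \<Rightarrow> 'a puiseux" where
  "minus_puiseux x y = x + (- y)"

definition divide_puiseux :: "'a puiseux \<Rightarrow> 'a puiseux \<Rightarrow> 'a puiseux" where
  "divide_puiseux x y = x * inverse y"

instance
proof
  fix a b c :: "'a puiseux"
  show "a + b + c = a + (b + c)"
    by transfer (auto simp: puiseux_rel_def fls_compose_power_compose algebra_simps)
  show "a * b * c = a * (b * c)"
    by transfer (auto simp: puiseux_rel_def fls_compose_power_compose algebra_simps)
  show "a + b = b + a"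
    by transfer (auto simp: puiseux_rel_def fls_compose_power_compose algebra_simps)
  show "a * b = b * a"
    by transfer (auto simp: puiseux_rel_def fls_compose_power_compose algebra_simps)
  show "(a + b) * c = a * c + b * c"
    by transfer (auto simp: puiseux_rel_def fls_compose_power_compose algebra_simps)
  show "0 + a = a"
    by transfer (auto simp: puiseux_rel_def fls_compose_power_compose)
  show "1 * a = a"
    by transfer (auto simp: puiseux_rel_def fls_compose_power_compose)
  show "- a + a = 0"
    by transfer (auto simp: puiseux_rel_def fls_compose_power_compose)
  show "a - b = a + - b" by (rule minus_puiseux_def)
  show "a div b = a * inverse b" by (rule divide_puiseux_def)
  show "(0::'a puiseux) \<noteq> 1"
    by transfer (simp add: puiseux_rel_def)
  show "inverse (0::'a puiseux) = 0"
    by transfer (auto simp: puiseux_rel_def)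
  have inv: "fls_compose_power (fls_compose_power (inverse f * f) n) (Suc 0) = 1"
    if "0 < n" "fls_compose_power f (Suc 0) \<noteq> 0" for n and f :: "'a fls"
  proof -
    have "f \<noteq> 0" using that(2) by auto
    then have "inverse f * f = 1" by simp
    then show ?thesis using that(1) by simp
  qed
  assume "a \<noteq> 0"
  then show "inverse a * a = 1"
    by transfer
      (auto simp: puiseux_rel_def inv simp del: fls_compose_power_mult simp flip: fls_compose_power_mult)
qed

end

text \<open>Both maps are only meaningful at nonzero arguments (both are \<open>0\<close> at \<open>0\<close>).\<close>

lift_definition puiseux_val :: "'a::field puiseux \<Rightarrow> real" is
  "\<lambda>(n, f). of_int (fls_subdegree f) / of_nat n"
proof (clarsimp simp: puiseux_rel_def)
  fix m n :: nat and f g :: "'a fls"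
  assume pos: "0 < m" "0 < n" and eq: "fls_compose_power f n = fls_compose_power g m"
  have "int n * fls_subdegree f = int m * fls_subdegree g"
    using pos eq by (metis fls_subdegree_compose_power)
  then have "real n * real_of_int (fls_subdegree f) = real m * real_of_int (fls_subdegree g)"
    by (metis of_int_mult of_int_of_nat_eq)
  then show "real_of_int (fls_subdegree f) / real m = real_of_int (fls_subdegree g) / real n"
    using pos by (simp add: field_simps)
qed

lift_definition puiseux_lc :: "'a::field puiseux \<Rightarrow> 'a" is
  "\<lambda>(n, f). fls_nth f (fls_subdegree f)"
proof (clarsimp simp: puiseux_rel_def)
  fix m n :: nat and f g :: "'a fls"
  assume pos: "0 < m" "0 < n" and eq: "fls_compose_power f n = fls_compose_power g m"
  have "fls_nth h (fls_subdegree h) =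
        fls_nth (fls_compose_power h k) (fls_subdegree (fls_compose_power h k))"
    if "k > 0" for h :: "'a fls" and k
    using that by (simp add: fls_subdegree_compose_power fls_nth_compose_power)
  then show "fls_nth f (fls_subdegree f) = fls_nth g (fls_subdegree g)"
    using pos eq by metis
qed

definition val_vec :: "('a::field puiseux)^'n \<Rightarrow> real^'n" where
  "val_vec x = (\<chi> j. puiseux_val (x $ j))"

definition lc_vec :: "('a::field puiseux)^'n \<Rightarrow> 'a^'n" where
  "lc_vec x = (\<chi> j. puiseux_lc (x $ j))"

text \<open>Polynomials over \<open>'a\<close> in variables indexed by the finite type \<open>'n\<close>, so \<open>N = CARD('n)\<close>.\<close>

type_synonym ('n, 'a) mpoly = "('n \<Rightarrow>\<^sub>0 nat) \<Rightarrow>\<^sub>0 'a"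

definition mconst :: "'a::zero \<Rightarrow> ('n, 'a) mpoly" where
  "mconst c = Poly_Mapping.single 0 c"

definition mvar :: "'n \<Rightarrow> ('n, 'a::zero_neq_one) mpoly" where
  "mvar j = Poly_Mapping.single (Poly_Mapping.single j 1) 1"

definition mmonom :: "('n \<Rightarrow>\<^sub>0 nat) \<Rightarrow> ('n, 'a::zero_neq_one) mpoly" where
  "mmonom \<alpha> = Poly_Mapping.single \<alpha> 1"

definition meval :: "('n::finite, 'a::comm_semiring_1) mpoly \<Rightarrow> 'a^'n \<Rightarrow> 'a" where
  "meval f x = (\<Sum>\<alpha>\<in>Poly_Mapping.keys f.
     Poly_Mapping.lookup f \<alpha> * (\<Prod>j\<in>UNIV. x $ j ^ Poly_Mapping.lookup \<alpha> j))"

text \<open>The ideal generated by a set is its span in the ring viewed as a module over itself.\<close>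

definition ideal_gen :: "'r::comm_ring_1 set \<Rightarrow> 'r set" where
  "ideal_gen = module.span (*)"

lemma module_mult: "module ((*) :: 'r::comm_ring_1 \<Rightarrow> 'r \<Rightarrow> 'r)"
  by unfold_locales (simp_all add: algebra_simps)

definition torus_zeros :: "('n::finite, 'a::comm_semiring_1) mpoly set \<Rightarrow> ('a^'n) set" where
  "torus_zeros F = {x. (\<forall>j. x $ j \<noteq> 0) \<and> (\<forall>f\<in>F. meval f x = 0)}"

definition term_weight ::
  "real^'n \<Rightarrow> ('n::finite, 'a::field puiseux) mpoly \<Rightarrow> ('n \<Rightarrow>\<^sub>0 nat) \<Rightarrow> real" where
  "term_weight v f \<alpha> =
     puiseux_val (Poly_Mapping.lookup f \<alpha>) + (\<Sum>j\<in>UNIV. real (Poly_Mapping.lookup \<alpha> j) * v $ j)"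

text \<open>The initial form of the zero polynomial is \<open>0\<close>, which does not affect initial ideals.\<close>

definition initial_form ::
  "real^'n \<Rightarrow> ('n::finite, 'a::field puiseux) mpoly \<Rightarrow> ('n, 'a) mpoly" where
  "initial_form v f =
     (\<Sum>\<alpha> | \<alpha> \<in> Poly_Mapping.keys f \<and>
            (\<forall>\<beta>\<in>Poly_Mapping.keys f. term_weight v f \<alpha> \<le> term_weight v f \<beta>).
        Poly_Mapping.single \<alpha> (puiseux_lc (Poly_Mapping.lookup f \<alpha>)))"

definition initial_ideal ::
  "real^'n \<Rightarrow> ('n::finite, 'a::field puiseux) mpoly set \<Rightarrow> ('n, 'a) mpoly set" where
  "initial_ideal v I = ideal_gen (initial_form v ` I)"

definition trop :: "('n::finite, 'a::field puiseux) mpoly set \<Rightarrow> (real^'n) set" where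
  "trop I = {v. \<forall>\<alpha>. mmonom \<alpha> \<notin> initial_ideal v I}"

text \<open>The coefficient \<open>c i S\<close> is used only for \<open>i \<notin> S\<close>.\<close>

definition equilibrium_poly ::
  "('n::finite \<Rightarrow> 'n set \<Rightarrow> 'a::comm_ring_1) \<Rightarrow> 'n \<Rightarrow> ('n, 'a) mpoly" where
  "equilibrium_poly c i = (\<Sum>S\<in>Pow (UNIV - {i}). mconst (c i S) * (\<Prod>j\<in>S. mvar j))"

definition equilibrium_ideal ::
  "('n::finite \<Rightarrow> 'n set \<Rightarrow> 'a::comm_ring_1) \<Rightarrow> ('n, 'a) mpoly set" where
  "equilibrium_ideal c = ideal_gen (range (equilibrium_poly c))"

definition exponent_diff_matrix ::
  "('n \<Rightarrow> 'n \<Rightarrow>\<^sub>0 nat) \<Rightarrow> ('n \<Rightarrow> 'n \<Rightarrow>\<^sub>0 nat) \<Rightarrow> int^'n^'n" where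
  "exponent_diff_matrix \<alpha> \<beta> =
     (\<chi> i j. int (Poly_Mapping.lookup (\<alpha> i) j) - int (Poly_Mapping.lookup (\<beta> i) j))"

definition exponent_diff_graph :: "int^'n^'n \<Rightarrow> ('n, 'n \<times> 'n) pre_digraph" where
  "exponent_diff_graph A =
     \<lparr>verts = UNIV, arcs = {(i, j). A $ i $ j \<noteq> 0}, tail = fst, head = snd\<rparr>"

text \<open>
  The submatrix of \<open>A\<close> with rows and columns in \<open>C\<close> is invertible over the integers. Being
  invertible does not depend on how \<open>C\<close> is enumerated, so the block is indexed by \<open>C\<close> itself.
\<close>

definition unimodular_block :: "int^'n^'n \<Rightarrow> 'n set \<Rightarrow> bool" where
  "unimodular_block A C \<longleftrightarrow>
     (\<exists>B :: 'n \<Rightarrow> 'n \<Rightarrow> int. \<forall>i\<in>C. \<forall>j\<in>C.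
        (\<Sum>k\<in>C. A $ i $ k * B k j) = (if i = j then 1 else 0) \<and>
        (\<Sum>k\<in>C. B i k * A $ k $ j) = (if i = j then 1 else 0))"

end

theory Submission
  imports Defs
begin

text \<open>
  A point of the torus annihilates a binomial \<open>a x\<^sup>\<alpha> + b x\<^sup>\<beta>\<close> iff the Laurent monomial
  \<open>x\<^sup>\<alpha>\<^sup>-\<^sup>\<beta>\<close> takes the value \<open>-b/a\<close> there. So the zeros of \<open>J\<close> are the solutions of a system
  \<open>(\<Prod>j. x\<^sub>j powi A\<^sub>i\<^sub>j) = d\<^sub>i\<close> with \<open>d\<^sub>i \<noteq> 0\<close>, a linear system with matrix \<open>A\<close> over the integers, written
  multiplicatively. A block with an integral inverse \<open>B\<close> is solved by \<open>x\<^sub>j = (\<Prod>k. d\<^sub>k powi B\<^sub>j\<^sub>k)\<close>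
  and by nothing else. The whole system is solved by back-substitution along the strongly
  connected components: if no edge leaves a set \<open>D\<close> of variables, the equations with indices in \<open>D\<close>
  involve only those variables; once they are solved, a component \<open>C\<close> whose edges stay in
  \<open>C \<union> D\<close> gives a system with matrix the block of \<open>C\<close> and a known right-hand side
  (\<open>monomial_system_solvable_closed\<close>).

  For the branches, the leading coefficient is multiplicative, and if \<open>f(x) = 0\<close> with
  \<open>val x = v\<close>, the terms of \<open>f(x)\<close> of smallest valuation \<open>w\<close> are those selected by the initial form.
  The coefficient of \<open>t\<^sup>w\<close> in \<open>f(x)\<close> is thus the value of the initial form at the
  leading coefficient vector of \<open>x\<close>, and it vanishes (\<open>meval_initial_form_lc_vec\<close>). Hence
  every branch with valuation \<open>v\<close> has as leading coefficient vector the only zero of \<open>J\<close>.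
\<close>

section \<open>Multiplicative systems with integral exponents\<close>

definition solves_monomial_system ::
  "int^'n^'n \<Rightarrow> 'n set \<Rightarrow> ('n \<Rightarrow> 'a::field) \<Rightarrow> ('n \<Rightarrow> 'a) \<Rightarrow> bool" where
  "solves_monomial_system A U d x \<longleftrightarrow>
     (\<forall>i\<in>U. x i \<noteq> 0 \<and> (\<Prod>j\<in>U. x j powi (A $ i $ j)) = d i)"

lemma prod_power_int_distrib:
  fixes f :: "'i \<Rightarrow> 'a::field"
  shows "(\<Prod>k\<in>S. f k) powi n = (\<Prod>k\<in>S. f k powi n)"
  by (induction S rule: infinite_finite_induct) (auto simp: power_int_mult_distrib)

lemma power_int_sum:
  fixes a :: "'a::field"
  assumes "a \<noteq> 0"
  shows "a powi (\<Sum>j\<in>S. n j) = (\<Prod>j\<in>S. a powi n j)"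
  using assms by (induction S rule: infinite_finite_induct) (auto simp: power_int_add)

text \<open>Composing monomial maps multiplies their exponent matrices.\<close>

lemma monomial_map_compose:
  fixes x :: "'n \<Rightarrow> 'a::field"
  assumes "\<And>k. k \<in> C \<Longrightarrow> x k \<noteq> 0"
  shows "(\<Prod>j\<in>C. (\<Prod>k\<in>C. x k powi N j k) powi m j) = (\<Prod>k\<in>C. x k powi (\<Sum>j\<in>C. m j * N j k))"
proof -
  have "(\<Prod>j\<in>C. (\<Prod>k\<in>C. x k powi N j k) powi m j) = (\<Prod>j\<in>C. \<Prod>k\<in>C. x k powi (m j * N j k))"
    by (simp add: prod_power_int_distrib power_int_mult mult.commute[of "m _"])
  also have "\<dots> = (\<Prod>k\<in>C. \<Prod>j\<in>C. x k powi (m j * N j k))"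
    by (rule prod.swap)
  also have "\<dots> = (\<Prod>k\<in>C. x k powi (\<Sum>j\<in>C. m j * N j k))"
    using assms by (intro prod.cong refl) (simp add: power_int_sum)
  finally show ?thesis .
qed

lemma prod_power_int_delta:
  fixes x :: "'n::finite \<Rightarrow> 'a::field"
  assumes "i \<in> C"
  shows "(\<Prod>k\<in>C. x k powi (if i = k then 1 else 0)) = x i"
proof -
  have "(\<Prod>k\<in>C. x k powi (if i = k then 1 else 0)) = (\<Prod>k\<in>C. if i = k then x k else 1)"
    by (intro prod.cong) auto
  then show ?thesis using assms by simp
qed

text \<open>
  The monomial map with exponent matrix the integral inverse of the block is a two-sided inverse
  of the monomial map of the block: one inverse property gives existence, the other uniqueness.
  The form \<open>\<exists>x. \<forall>y. \<dots>\<close>, here and below, states both at once, up to the values of \<open>y\<close>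
  outside the block.
\<close>

lemma monomial_system_solvable_unimodular:
  fixes d :: "'n::finite \<Rightarrow> 'a::field"
  assumes "unimodular_block A C" and d: "\<And>i. i \<in> C \<Longrightarrow> d i \<noteq> 0"
  shows "\<exists>x. \<forall>y. solves_monomial_system A C d y \<longleftrightarrow> (\<forall>i\<in>C. y i = x i)"
proof -
  obtain B :: "'n \<Rightarrow> 'n \<Rightarrow> int" where B: "\<forall>i\<in>C. \<forall>j\<in>C.
      (\<Sum>k\<in>C. A $ i $ k * B k j) = (if i = j then 1 else 0) \<and>
      (\<Sum>k\<in>C. B i k * A $ k $ j) = (if i = j then 1 else 0)"
    using assms(1) unfolding unimodular_block_def by blast
  define x where "x i = (\<Prod>k\<in>C. d k powi B i k)" for i
  have x0: "x i \<noteq> 0" for i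
    using d by (auto simp: x_def)
  have sol: "(\<Prod>j\<in>C. x j powi (A $ i $ j)) = d i" if "i \<in> C" for i
  proof -
    have "(\<Prod>j\<in>C. x j powi (A $ i $ j)) = (\<Prod>k\<in>C. d k powi (\<Sum>j\<in>C. A $ i $ j * B j k))"
      unfolding x_def by (rule monomial_map_compose) (rule d)
    also have "\<dots> = (\<Prod>k\<in>C. d k powi (if i = k then 1 else 0))"
      using that by (intro prod.cong refl) (simp add: B)
    finally show ?thesis using that by (simp only: prod_power_int_delta)
  qed
  have uniq: "y i = x i" if y: "solves_monomial_system A C d y" and i: "i \<in> C" for y i
  proof -
    have "x i = (\<Prod>k\<in>C. (\<Prod>j\<in>C. y j powi (A $ k $ j)) powi B i k)"
      using y by (auto simp: x_def solves_monomial_system_def intro!: prod.cong)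
    also have "\<dots> = (\<Prod>j\<in>C. y j powi (\<Sum>k\<in>C. B i k * A $ k $ j))"
      using y by (intro monomial_map_compose) (simp add: solves_monomial_system_def)
    also have "\<dots> = (\<Prod>j\<in>C. y j powi (if i = j then 1 else 0))"
      using i by (intro prod.cong refl) (simp add: B)
    finally show ?thesis using i by (simp only: prod_power_int_delta)
  qed
  have "solves_monomial_system A C d y \<longleftrightarrow> (\<forall>i\<in>C. y i = x i)" for y
    using uniq sol x0 by (auto simp: solves_monomial_system_def)
  then show ?thesis by blast
qed

lemma solves_monomial_system_cong:
  assumes "\<And>i. i \<in> U \<Longrightarrow> d i = d' i"
  shows "solves_monomial_system A U d y \<longleftrightarrow> solves_monomial_system A U d' y"
  using assms by (simp add: solves_monomial_system_def)

text \<open>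
  One step of back-substitution: the variables in \<open>D\<close> are solved for alone, and their known
  contribution to the equations with indices in \<open>C\<close> is moved to the right-hand side.
\<close>

lemma solves_monomial_system_Un:
  fixes d :: "'n::finite \<Rightarrow> 'a::field"
  assumes disj: "C \<inter> D = {}" and zero: "\<And>i j. i \<in> D \<Longrightarrow> j \<in> C \<Longrightarrow> A $ i $ j = 0"
  shows "solves_monomial_system A (C \<union> D) d y \<longleftrightarrow>
     solves_monomial_system A D d y \<and>
     solves_monomial_system A C (\<lambda>i. d i / (\<Prod>j\<in>D. y j powi (A $ i $ j))) y"
proof -
  have split: "(\<Prod>j\<in>C \<union> D. y j powi (A $ i $ j)) =
      (\<Prod>j\<in>C. y j powi (A $ i $ j)) * (\<Prod>j\<in>D. y j powi (A $ i $ j))" for i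
    using disj by (simp add: prod.union_disjoint)
  have C1: "(\<Prod>j\<in>C. y j powi (A $ i $ j)) = 1" if "i \<in> D" for i
    using that zero by simp
  have D0: "(\<Prod>j\<in>D. y j powi (A $ i $ j)) \<noteq> 0" if "\<forall>j\<in>D. y j \<noteq> 0" for i
    using that by simp
  show ?thesis
  proof (cases "\<forall>j\<in>D. y j \<noteq> 0")
    case True
    then show ?thesis
      using C1 D0[OF True]
      by (auto simp: solves_monomial_system_def split ball_Un nonzero_eq_divide_eq)
  next
    case False
    then show ?thesis by (auto simp: solves_monomial_system_def)
  qed
qed

lemma monomial_system_solvable_Un:
  fixes d :: "'n::finite \<Rightarrow> 'a::field"
  assumes disj: "C \<inter> D = {}" and zero: "\<And>i j. i \<in> D \<Longrightarrow> j \<in> C \<Longrightarrow> A $ i $ j = 0"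
    and C: "unimodular_block A C"
    and D: "\<exists>x. \<forall>y. solves_monomial_system A D d y \<longleftrightarrow> (\<forall>i\<in>D. y i = x i)"
    and d: "\<And>i. i \<in> C \<Longrightarrow> d i \<noteq> 0"
  shows "\<exists>x. \<forall>y. solves_monomial_system A (C \<union> D) d y \<longleftrightarrow> (\<forall>i\<in>C \<union> D. y i = x i)"
proof -
  obtain x where x: "\<And>y. solves_monomial_system A D d y \<longleftrightarrow> (\<forall>i\<in>D. y i = x i)"
    using D by blast
  have x0: "x i \<noteq> 0" if "i \<in> D" for i
    using x[of x] that by (auto simp: solves_monomial_system_def)
  define d' where "d' i = d i / (\<Prod>j\<in>D. x j powi (A $ i $ j))" for i
  have "d' i \<noteq> 0" if "i \<in> C" for i
    using d x0 that by (simp add: d'_def)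
  then obtain z where z: "\<And>y. solves_monomial_system A C d' y \<longleftrightarrow> (\<forall>i\<in>C. y i = z i)"
    using monomial_system_solvable_unimodular[OF C] by blast
  have "solves_monomial_system A (C \<union> D) d y \<longleftrightarrow>
      (\<forall>i\<in>C \<union> D. y i = (if i \<in> C then z i else x i))" for y
  proof -
    have "solves_monomial_system A (C \<union> D) d y \<longleftrightarrow>
        (\<forall>i\<in>D. y i = x i) \<and>
        solves_monomial_system A C (\<lambda>i. d i / (\<Prod>j\<in>D. y j powi (A $ i $ j))) y"
      using solves_monomial_system_Un[OF disj zero] x by blast
    also have "\<dots> \<longleftrightarrow> (\<forall>i\<in>D. y i = x i) \<and> solves_monomial_system A C d' y"
      by (auto simp: d'_def cong: solves_monomial_system_cong)
    also have "\<dots> \<longleftrightarrow> (\<forall>i\<in>C \<union> D. y i = (if i \<in> C then z i else x i))"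
      using disj by (auto simp: z)
    finally show ?thesis .
  qed
  then show ?thesis
    by (intro exI[of _ "\<lambda>i. if i \<in> C then z i else x i"] allI)
qed

lemma reachable_exponent_diff_graph:
  "i \<rightarrow>\<^sup>*\<^bsub>exponent_diff_graph A\<^esub> j \<longleftrightarrow> (i, j) \<in> {(i, j). A $ i $ j \<noteq> 0}\<^sup>*"
proof -
  have "arcs_ends (exponent_diff_graph A) = {(i, j). A $ i $ j \<noteq> 0}"
    by (auto simp: exponent_diff_graph_def arcs_ends_def arc_to_ends_def image_def)
  moreover have "(i, j) \<in> rtrancl_on UNIV R" if "(i, j) \<in> R\<^sup>*" for R
    using that by (induction rule: rtrancl_induct) (auto intro: rtrancl_on_into_rtrancl_on)
  ultimately show ?thesis
    by (auto simp: reachable_def exponent_diff_graph_def dest: rtrancl_on_rtranclI)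
qed

definition edge_closed :: "int^'n^'n \<Rightarrow> 'n set \<Rightarrow> bool" where
  "edge_closed A U \<longleftrightarrow> (\<forall>i\<in>U. \<forall>j. A $ i $ j \<noteq> 0 \<longrightarrow> j \<in> U)"

text \<open>
  A nonempty set \<open>U\<close> that no edge leaves has a strongly connected component entered by no edge
  from the rest of \<open>U\<close>: the component of a vertex \<open>i\<close> in \<open>U\<close> that reaches the most vertices. If \<open>k\<close> in
  \<open>U\<close> reaches \<open>i\<close>, then \<open>k\<close> reaches all that \<open>i\<close> reaches, so by maximality \<open>i\<close> reaches \<open>k\<close> as well.
\<close>

lemma closed_set_source_component:
  fixes A :: "int^'n::finite^'n"
  assumes closed: "edge_closed A U" and "U \<noteq> {}"
  obtains C where "C \<in> pre_digraph.sccs_verts (exponent_diff_graph A)" "C \<noteq> {}" "C \<subseteq> U"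
    "edge_closed A (U - C)"
proof -
  define E where "E = {(i, j). A $ i $ j \<noteq> 0}"
  define R where "R i = {j. (i, j) \<in> E\<^sup>*}" for i
  have "Max ((\<lambda>k. card (R k)) ` U) \<in> (\<lambda>k. card (R k)) ` U"
    using \<open>U \<noteq> {}\<close> by (intro Max_in) auto
  then obtain i where i: "i \<in> U" "Max ((\<lambda>k. card (R k)) ` U) = card (R i)"
    by blast
  then have max: "card (R k) \<le> card (R i)" if "k \<in> U" for k
    using that by (metis Max_ge finite finite_imageI image_eqI)
  define C where "C = {j. (i, j) \<in> E\<^sup>* \<and> (j, i) \<in> E\<^sup>*}"
  have reach_U: "j \<in> U" if "(k, j) \<in> E\<^sup>*" "k \<in> U" for k j
    using that by (induction rule: rtrancl_induct) (use closed in \<open>auto simp: E_def edge_closed_def\<close>)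
  show thesis
  proof
    show "C \<noteq> {}" "C \<subseteq> U"
      using reach_U i by (auto simp: C_def)
    show "C \<in> pre_digraph.sccs_verts (exponent_diff_graph A)"
      unfolding pre_digraph.sccs_verts_def reachable_exponent_diff_graph E_def[symmetric]
    proof (intro CollectI conjI ballI allI impI)
      fix u assume u: "u \<in> C"
      show "(u, w) \<in> E\<^sup>*" if "w \<in> C" for w
        using u that rtrancl_trans[of u i E w] by (simp add: C_def)
      show "(u, w) \<notin> E\<^sup>* \<or> (w, u) \<notin> E\<^sup>*" if "w \<notin> C" for w
        using u that rtrancl_trans[of i u E w] rtrancl_trans[of w u E i] by (auto simp: C_def)
    qed (use \<open>C \<noteq> {}\<close> in simp)
    have "j \<notin> C" if k: "k \<in> U - C" and kj: "A $ k $ j \<noteq> 0" for k j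
    proof
      assume "j \<in> C"
      with kj have ki: "(k, i) \<in> E\<^sup>*"
        by (auto simp: C_def E_def intro: converse_rtrancl_into_rtrancl)
      then have "R i \<subseteq> R k"
        using rtrancl_trans[OF ki] by (auto simp: R_def)
      then have "R i = R k"
        using max[of k] k by (intro card_seteq) auto
      then have "k \<in> R i"
        by (simp add: R_def)
      then have "(i, k) \<in> E\<^sup>*"
        by (simp add: R_def)
      with ki k show False by (auto simp: C_def)
    qed
    then show "edge_closed A (U - C)"
      using closed by (auto simp: edge_closed_def)
  qed
qed

text \<open>
  Induction on the size of \<open>U\<close>: the set left after removing a source component is again closed, so
  its part of the system is solved first.
\<close>

lemma monomial_system_solvable_closed:
  fixes A :: "int^'n::finite^'n" and d :: "'n \<Rightarrow> 'a::field"
  assumes unimodular: "\<And>C. C \<in> pre_digraph.sccs_verts (exponent_diff_graph A) \<Longrightarrow> unimodular_block A C"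
    and d: "\<And>i. d i \<noteq> 0"
    and closed: "edge_closed A U"
  shows "\<exists>x. \<forall>y. solves_monomial_system A U d y \<longleftrightarrow> (\<forall>i\<in>U. y i = x i)"
  using finite[of U] closed
proof (induction U rule: finite_psubset_induct)
  case (psubset U)
  show ?case
  proof (cases "U = {}")
    case True
    then show ?thesis by (simp add: solves_monomial_system_def)
  next
    case False
    obtain C where C: "C \<in> pre_digraph.sccs_verts (exponent_diff_graph A)" "C \<noteq> {}" "C \<subseteq> U"
      "edge_closed A (U - C)"
      using closed_set_source_component[OF psubset.prems False] by blast
    have "U - C \<subset> U" using C by blast
    then have IH: "\<exists>x. \<forall>y. solves_monomial_system A (U - C) d y \<longleftrightarrow> (\<forall>i\<in>U - C. y i = x i)"
      using C(4) by (rule psubset.IH)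
    have zero: "A $ i $ j = 0" if "i \<in> U - C" "j \<in> C" for i j
      using C(4) that unfolding edge_closed_def by blast
    have "\<exists>x. \<forall>y. solves_monomial_system A (C \<union> (U - C)) d y \<longleftrightarrow>
        (\<forall>i\<in>C \<union> (U - C). y i = x i)"
    proof (rule monomial_system_solvable_Un)
      show "C \<inter> (U - C) = {}" by blast
      show "unimodular_block A C" by (rule unimodular) (rule C(1))
      show "d i \<noteq> 0" for i by (rule d)
    qed (fact zero IH)+
    moreover have "C \<union> (U - C) = U" using C(3) by blast
    ultimately show ?thesis by simp
  qed
qed

section \<open>Evaluation and ideals\<close>

lemma meval_superset:
  fixes f :: "('n::finite, 'a::comm_semiring_1) mpoly"
  assumes "finite S" "Poly_Mapping.keys f \<subseteq> S"
  shows "meval f x =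
    (\<Sum>\<alpha>\<in>S. Poly_Mapping.lookup f \<alpha> * (\<Prod>j\<in>UNIV. x $ j ^ Poly_Mapping.lookup \<alpha> j))"
  unfolding meval_def using assms by (intro sum.mono_neutral_left) (auto simp: in_keys_iff)

lemma meval_zero [simp]: "meval 0 x = 0"
  by (simp add: meval_def)

lemma meval_add:
  fixes f g :: "('n::finite, 'a::comm_semiring_1) mpoly"
  shows "meval (f + g) x = meval f x + meval g x"
proof -
  let ?S = "Poly_Mapping.keys f \<union> Poly_Mapping.keys g"
  have "Poly_Mapping.keys (f + g) \<subseteq> ?S" by (rule keys_add)
  then show ?thesis
    by (simp add: meval_superset[of ?S] lookup_add distrib_right sum.distrib)
qed

lemma meval_sum: "meval (\<Sum>i\<in>S. f i) x = (\<Sum>i\<in>S. meval (f i) x)"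
  by (induction S rule: infinite_finite_induct) (auto simp: meval_add)

lemma meval_single:
  "meval (Poly_Mapping.single \<alpha> a) x = a * (\<Prod>j\<in>UNIV. x $ j ^ Poly_Mapping.lookup \<alpha> j)"
  by (subst meval_superset[of "{\<alpha>}"]) auto

lemma mpoly_sum_terms:
  fixes f :: "('n, 'a::comm_monoid_add) mpoly"
  shows "f = (\<Sum>\<alpha>\<in>Poly_Mapping.keys f. Poly_Mapping.single \<alpha> (Poly_Mapping.lookup f \<alpha>))"
  by (rule poly_mapping_eqI) (auto simp: lookup_sum lookup_single when_def in_keys_iff)

lemma meval_mult:
  fixes f g :: "('n::finite, 'a::comm_semiring_1) mpoly"
  shows "meval (f * g) x = meval f x * meval g x"
proof -
  let ?t = "\<lambda>f \<alpha>. Poly_Mapping.single \<alpha> (Poly_Mapping.lookup f \<alpha>)"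
  have "meval (f * g) x = meval ((\<Sum>\<alpha>\<in>Poly_Mapping.keys f. ?t f \<alpha>) * (\<Sum>\<beta>\<in>Poly_Mapping.keys g. ?t g \<beta>)) x"
    by (simp flip: mpoly_sum_terms)
  also have "\<dots> = (\<Sum>\<alpha>\<in>Poly_Mapping.keys f. \<Sum>\<beta>\<in>Poly_Mapping.keys g. meval (?t f \<alpha> * ?t g \<beta>) x)"
    by (simp add: sum_product meval_sum)
  also have "\<dots> = (\<Sum>\<alpha>\<in>Poly_Mapping.keys f. \<Sum>\<beta>\<in>Poly_Mapping.keys g. meval (?t f \<alpha>) x * meval (?t g \<beta>) x)"
    by (simp add: mult_single meval_single lookup_add power_add prod.distrib mult_ac)
  also have "\<dots> = meval f x * meval g x"
    by (simp only: meval_single) (simp add: meval_def sum_product)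
  finally show ?thesis .
qed

lemma torus_zeros_ideal_gen:
  fixes F :: "('n::finite, 'a::comm_ring_1) mpoly set"
  shows "torus_zeros (ideal_gen F) = torus_zeros F"
proof -
  interpret module "(*) :: ('n, 'a) mpoly \<Rightarrow> _" by (rule module_mult)
  have "meval f x = 0" if "f \<in> ideal_gen F" "\<forall>g\<in>F. meval g x = 0" for f x
    using that(1) unfolding ideal_gen_def
    by (induction rule: span_induct_alt) (use that(2) in \<open>auto simp: meval_add meval_mult\<close>)
  moreover have "F \<subseteq> ideal_gen F"
    unfolding ideal_gen_def by (rule span_superset)
  ultimately show ?thesis
    unfolding torus_zeros_def by blast
qed

section \<open>Leading coefficients of Puiseux series\<close>

lemma fls_compose_power_eq_0_iff: "n > 0 \<Longrightarrow> fls_compose_power f n = 0 \<longleftrightarrow> f = 0"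
  using fls_compose_power_inject[of n f 0] by auto

lemma puiseux_lc_mult: "puiseux_lc (p * q) = puiseux_lc p * puiseux_lc q"
proof (transfer, clarsimp simp: puiseux_rel_def simp del: fls_compose_power_mult)
  fix m n :: nat and f g :: "'a fls"
  assume pos: "0 < m" "0 < n"
  define F G where "F = fls_compose_power f n" and "G = fls_compose_power g m"
  have "fls_nth (F * G) (fls_subdegree (F * G)) = fls_nth F (fls_subdegree F) * fls_nth G (fls_subdegree G)"
    by (cases "F = 0 \<or> G = 0") auto
  then show "fls_nth (fls_compose_power f n * fls_compose_power g m)
      (fls_subdegree (fls_compose_power f n * fls_compose_power g m)) =
      fls_nth f (fls_subdegree f) * fls_nth g (fls_subdegree g)"
    using pos by (simp add: F_def G_def fls_subdegree_compose_power fls_nth_compose_power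
        del: fls_compose_power_mult)
qed

lemma puiseux_lc_1 [simp]: "puiseux_lc 1 = 1"
  by transfer simp

lemma puiseux_lc_eq_0_iff [simp]: "puiseux_lc p = 0 \<longleftrightarrow> p = 0"
  by transfer (auto simp: puiseux_rel_def fls_compose_power_eq_0_iff nth_fls_subdegree_zero_iff)

lemma puiseux_lc_power: "puiseux_lc (p ^ n) = puiseux_lc p ^ n"
  by (induction n) (auto simp: puiseux_lc_mult)

lemma puiseux_lc_prod: "puiseux_lc (\<Prod>i\<in>S. p i) = (\<Prod>i\<in>S. puiseux_lc (p i))"
  by (induction S rule: infinite_finite_induct) (auto simp: puiseux_lc_mult)

lemma fls_subdegree_mult_compose_power:
  fixes f g :: "'a::field fls"
  assumes "m > 0" "n > 0" "f \<noteq> 0" "g \<noteq> 0"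
  shows "real_of_int (fls_subdegree (fls_compose_power f n * fls_compose_power g m)) / (real m * real n) =
    real_of_int (fls_subdegree f) / real m + real_of_int (fls_subdegree g) / real n"
  using assms by (simp add: fls_subdegree_compose_power fls_compose_power_eq_0_iff field_simps
      del: fls_compose_power_mult)

lemma puiseux_val_mult:
  "p \<noteq> 0 \<Longrightarrow> q \<noteq> 0 \<Longrightarrow> puiseux_val (p * q) = puiseux_val p + puiseux_val q"
proof (transfer, goal_cases)
  case (1 p q)
  obtain m f n g where pq: "p = (m, f)" "q = (n, g)"
    by (cases p, cases q)
  with 1 have "m > 0" "n > 0" "f \<noteq> 0" "g \<noteq> 0"
    by (auto simp: puiseux_rel_def)
  then show ?case
    by (simp add: pq fls_subdegree_mult_compose_power del: fls_compose_power_mult)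
qed

lemma puiseux_val_1 [simp]: "puiseux_val 1 = 0"
  by transfer simp

lemma puiseux_val_power: "p \<noteq> 0 \<Longrightarrow> puiseux_val (p ^ n) = real n * puiseux_val p"
  by (induction n) (auto simp: puiseux_val_mult algebra_simps)

lemma puiseux_val_prod:
  "(\<And>i. i \<in> S \<Longrightarrow> p i \<noteq> 0) \<Longrightarrow> puiseux_val (\<Prod>i\<in>S. p i) = (\<Sum>i\<in>S. puiseux_val (p i))"
  by (induction S rule: infinite_finite_induct) (auto simp: puiseux_val_mult)

text \<open>
  The coefficient of \<open>t\<^sup>r\<close> in \<open>f(t\<^sup>1\<^sup>/\<^sup>n)\<close>, which is \<open>0\<close> unless \<open>rn\<close> is an integer. The
  exponent \<open>r\<close> ranges over the reals because it will be the weight of a term, and \<open>v\<close> is real.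
\<close>

definition ramified_coeff :: "real \<Rightarrow> nat \<Rightarrow> 'a::zero fls \<Rightarrow> 'a" where
  "ramified_coeff r n f = (if r * real n \<in> \<int> then fls_nth f \<lfloor>r * real n\<rfloor> else 0)"

text \<open>Passing to a larger denominator changes no coefficient, so the coefficients descend to Puiseux series.\<close>

lemma ramified_coeff_compose_power:
  assumes "k > 0" "m > 0"
  shows "ramified_coeff r (m * k) (fls_compose_power f k) = ramified_coeff r m f"
proof (cases "r * real m \<in> \<int>")
  case True
  then obtain l where l: "r * real m = of_int l" by (elim Ints_cases)
  then have "r * real (m * k) = of_int (int k * l)"
    by (simp add: mult.assoc[symmetric])
  then have "r * real (m * k) \<in> \<int>" "\<lfloor>r * real (m * k)\<rfloor> = int k * l"
    by (simp_all only: Ints_of_int floor_of_int)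
  with l assms show ?thesis
    by (simp add: ramified_coeff_def fls_nth_compose_power del: of_nat_mult)
next
  case False
  have "\<not> int k dvd \<lfloor>r * real (m * k)\<rfloor>" if "r * real (m * k) \<in> \<int>"
  proof
    assume "int k dvd \<lfloor>r * real (m * k)\<rfloor>"
    then obtain l where "\<lfloor>r * real (m * k)\<rfloor> = int k * l" by blast
    with that have "r * real (m * k) = of_int (int k * l)"
      by (metis Ints_cases floor_of_int)
    then have "r * real m = of_int l"
      using assms by simp
    with False show False by simp
  qed
  with False assms show ?thesis
    by (auto simp: ramified_coeff_def fls_nth_compose_power)
qed

lift_definition puiseux_coeff :: "real \<Rightarrow> 'a::field puiseux \<Rightarrow> 'a" is
  "\<lambda>r (n, f). ramified_coeff r n f"
proof (clarsimp simp: puiseux_rel_def)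
  fix r :: real and m n :: nat and f g :: "'a fls"
  assume "0 < m" "0 < n" "fls_compose_power f n = fls_compose_power g m"
  then show "ramified_coeff r m f = ramified_coeff r n g"
    by (metis ramified_coeff_compose_power mult.commute)
qed

lemma puiseux_coeff_0 [simp]: "puiseux_coeff r 0 = 0"
  by transfer (simp add: ramified_coeff_def)

lemma puiseux_coeff_add: "puiseux_coeff r (p + q) = puiseux_coeff r p + puiseux_coeff r q"
proof (transfer, clarsimp simp: puiseux_rel_def)
  fix r :: real and m n :: nat and f g :: "'a fls"
  assume pos: "0 < m" "0 < n"
  have "ramified_coeff r (m * n) (fls_compose_power f n + fls_compose_power g m) =
      ramified_coeff r (m * n) (fls_compose_power f n) + ramified_coeff r (n * m) (fls_compose_power g m)"
    by (simp add: ramified_coeff_def mult.commute)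
  then show "ramified_coeff r (m * n) (fls_compose_power f n + fls_compose_power g m) =
      ramified_coeff r m f + ramified_coeff r n g"
    using pos by (simp only: ramified_coeff_compose_power)
qed

lemma puiseux_coeff_sum: "puiseux_coeff r (\<Sum>i\<in>S. p i) = (\<Sum>i\<in>S. puiseux_coeff r (p i))"
  by (induction S rule: infinite_finite_induct) (auto simp: puiseux_coeff_add)

lemma puiseux_coeff_val: "puiseux_coeff (puiseux_val p) p = puiseux_lc p"
  by transfer (auto simp: ramified_coeff_def puiseux_rel_def)

lemma puiseux_coeff_less_val: "r < puiseux_val p \<Longrightarrow> puiseux_coeff r p = 0"
proof (transfer, clarsimp simp: puiseux_rel_def ramified_coeff_def)
  fix r :: real and n :: nat and f :: "'a fls"
  assume "r < real_of_int (fls_subdegree f) / real n" "0 < n" "r * real n \<in> \<int>"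
  then have "\<lfloor>r * real n\<rfloor> < fls_subdegree f"
    by (simp add: floor_less_iff field_simps)
  then show "fls_nth f \<lfloor>r * real n\<rfloor> = 0" by (rule fls_eq0_below_subdegree)
qed

text \<open>
  The coefficient of \<open>t\<^sup>w\<close> in the value of \<open>f\<close> at \<open>x\<close>, for the smallest weight \<open>w\<close> of a term:
  heavier terms contribute nothing to it, and a term of weight \<open>w\<close> contributes its leading coefficient.
\<close>

lemma meval_initial_form_lc_vec:
  fixes f :: "('n::finite, 'a::field puiseux) mpoly"
  assumes zero: "meval f x = 0" and x: "\<And>j. x $ j \<noteq> 0" and val: "val_vec x = v"
  shows "meval (initial_form v f) (lc_vec x) = 0"
proof (cases "f = 0")
  case True
  then show ?thesis by (simp add: initial_form_def)
next
  case False
  define K where "K = Poly_Mapping.keys f"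
  define M where "M = {\<alpha> \<in> K. \<forall>\<beta>\<in>K. term_weight v f \<alpha> \<le> term_weight v f \<beta>}"
  define T where "T \<alpha> = Poly_Mapping.lookup f \<alpha> * (\<Prod>j\<in>UNIV. x $ j ^ Poly_Mapping.lookup \<alpha> j)" for \<alpha>
  have K: "finite K" "K \<noteq> {}" using False by (auto simp: K_def)
  define w where "w = Min (term_weight v f ` K)"
  have w_le: "w \<le> term_weight v f \<alpha>" if "\<alpha> \<in> K" for \<alpha>
    using K that by (simp add: w_def)
  have "w \<in> term_weight v f ` K"
    unfolding w_def using K by (intro Min_in) auto
  then obtain \<alpha>\<^sub>0 where \<alpha>\<^sub>0: "\<alpha>\<^sub>0 \<in> K" "term_weight v f \<alpha>\<^sub>0 = w"
    by blast
  have M_iff: "\<alpha> \<in> M \<longleftrightarrow> term_weight v f \<alpha> = w" if "\<alpha> \<in> K" for \<alpha>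
  proof
    assume "\<alpha> \<in> M"
    then have "term_weight v f \<alpha> \<le> w"
      using \<alpha>\<^sub>0 by (auto simp: M_def)
    with w_le[OF that] show "term_weight v f \<alpha> = w" by simp
  next
    assume "term_weight v f \<alpha> = w"
    with that w_le show "\<alpha> \<in> M" by (simp add: M_def)
  qed
  have vj: "puiseux_val (x $ j) = v $ j" for j
    using val by (auto simp: val_vec_def)
  have valT: "puiseux_val (T \<alpha>) = term_weight v f \<alpha>" if "\<alpha> \<in> K" for \<alpha>
    using that x by (simp add: T_def K_def term_weight_def puiseux_val_mult puiseux_val_prod
        puiseux_val_power vj in_keys_iff)
  have lcT: "puiseux_lc (T \<alpha>) =
      puiseux_lc (Poly_Mapping.lookup f \<alpha>) * (\<Prod>j\<in>UNIV. lc_vec x $ j ^ Poly_Mapping.lookup \<alpha> j)" for \<alpha>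
    by (simp add: T_def puiseux_lc_mult puiseux_lc_prod puiseux_lc_power lc_vec_def)
  have coeffT: "puiseux_coeff w (T \<alpha>) = (if \<alpha> \<in> M then puiseux_lc (T \<alpha>) else 0)" if "\<alpha> \<in> K" for \<alpha>
  proof (cases "\<alpha> \<in> M")
    case True
    then show ?thesis
      using puiseux_coeff_val[of "T \<alpha>"] by (simp add: valT[OF that] M_iff[OF that])
  next
    case False
    then have "w < puiseux_val (T \<alpha>)"
      using w_le[OF that] M_iff[OF that] valT[OF that] by linarith
    then show ?thesis using False by (simp add: puiseux_coeff_less_val)
  qed
  have "M \<subseteq> K" by (auto simp: M_def)
  have "meval (initial_form v f) (lc_vec x) = (\<Sum>\<alpha>\<in>M. puiseux_lc (T \<alpha>))"
    by (simp add: initial_form_def meval_sum meval_single lcT M_def K_def)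
  also have "\<dots> = (\<Sum>\<alpha>\<in>K. if \<alpha> \<in> M then puiseux_lc (T \<alpha>) else 0)"
    using K(1) \<open>M \<subseteq> K\<close> by (intro sum.mono_neutral_cong_left) auto
  also have "\<dots> = (\<Sum>\<alpha>\<in>K. puiseux_coeff w (T \<alpha>))"
    by (simp add: coeffT)
  also have "\<dots> = puiseux_coeff w (meval f x)"
    by (simp add: meval_def T_def K_def puiseux_coeff_sum)
  finally show ?thesis by (simp add: zero)
qed

section \<open>Binomial systems\<close>

lemma meval_binomial_eq_0_iff:
  fixes g :: "('n::finite, 'a::field) mpoly"
  assumes keys: "Poly_Mapping.keys g = {\<alpha>, \<beta>}" "\<alpha> \<noteq> \<beta>" and x: "\<And>j. x $ j \<noteq> 0"
  shows "meval g x = 0 \<longleftrightarrow>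
    (\<Prod>j\<in>UNIV. x $ j powi (int (Poly_Mapping.lookup \<alpha> j) - int (Poly_Mapping.lookup \<beta> j))) =
    - Poly_Mapping.lookup g \<beta> / Poly_Mapping.lookup g \<alpha>"
proof -
  let ?X = "\<lambda>\<alpha>. \<Prod>j\<in>UNIV. x $ j ^ Poly_Mapping.lookup \<alpha> j"
  have "meval g x = Poly_Mapping.lookup g \<alpha> * ?X \<alpha> + Poly_Mapping.lookup g \<beta> * ?X \<beta>"
    using keys by (simp add: meval_def)
  moreover have "(\<Prod>j\<in>UNIV. x $ j powi (int (Poly_Mapping.lookup \<alpha> j) - int (Poly_Mapping.lookup \<beta> j))) =
      ?X \<alpha> / ?X \<beta>"
    using x by (simp add: power_int_diff prod_dividef)
  moreover have "a * X + b * Y = 0 \<longleftrightarrow> X / Y = - b / a" if "a \<noteq> 0" "Y \<noteq> 0" for a b X Y :: 'a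
  proof -
    have "X / Y = - b / a \<longleftrightarrow> X * a = - b * Y"
      using that by (intro frac_eq_eq) auto
    also have "\<dots> \<longleftrightarrow> a * X + b * Y = 0"
      by (simp add: eq_neg_iff_add_eq_0 mult.commute)
    finally show ?thesis by simp
  qed
  moreover have "?X \<beta> \<noteq> 0" using x by simp
  moreover have "Poly_Mapping.lookup g \<alpha> \<noteq> 0"
    using keys by (auto simp flip: in_keys_iff)
  ultimately show ?thesis
    by simp
qed

lemma torus_zeros_binomials_singleton:
  fixes g :: "'n::finite \<Rightarrow> ('n, 'a::field) mpoly" and \<alpha> \<beta> :: "'n \<Rightarrow> 'n \<Rightarrow>\<^sub>0 nat"
  defines "A \<equiv> exponent_diff_matrix \<alpha> \<beta>"
  assumes keys: "\<And>i. Poly_Mapping.keys (g i) = {\<alpha> i, \<beta> i}" "\<And>i. \<alpha> i \<noteq> \<beta> i"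
    and unimodular: "\<And>C. C \<in> pre_digraph.sccs_verts (exponent_diff_graph A) \<Longrightarrow> unimodular_block A C"
  shows "\<exists>p. torus_zeros (range g) = {p}"
proof -
  define d where "d i = - Poly_Mapping.lookup (g i) (\<beta> i) / Poly_Mapping.lookup (g i) (\<alpha> i)" for i
  have d0: "d i \<noteq> 0" for i
    using keys(1)[of i] by (auto simp: d_def simp flip: in_keys_iff)
  obtain z where z: "\<And>y. solves_monomial_system A UNIV d y \<longleftrightarrow> (\<forall>i\<in>UNIV. y i = z i)"
    using monomial_system_solvable_closed[of A d UNIV] unimodular d0
    by (auto simp: edge_closed_def)
  have "x \<in> torus_zeros (range g) \<longleftrightarrow> solves_monomial_system A UNIV d (($) x)" for x
  proof (cases "\<forall>j. x $ j \<noteq> 0")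
    case True
    then show ?thesis
      by (simp add: torus_zeros_def solves_monomial_system_def A_def exponent_diff_matrix_def d_def
          meval_binomial_eq_0_iff[OF keys])
  next
    case False
    then show ?thesis by (auto simp: torus_zeros_def solves_monomial_system_def)
  qed
  then have "torus_zeros (range g) = {\<chi> i. z i}"
    by (auto simp: z vec_eq_iff)
  then show ?thesis by blast
qed

theorem theorem1p1:
  fixes c :: "'n::finite \<Rightarrow> 'n set \<Rightarrow> complex puiseux"
    and v :: "real^'n"
    and \<alpha> \<beta> :: "'n \<Rightarrow> 'n \<Rightarrow>\<^sub>0 nat"
  defines "I \<equiv> equilibrium_ideal c"
    and "J \<equiv> ideal_gen (range (\<lambda>i. initial_form v (equilibrium_poly c i)))"
    and "A \<equiv> exponent_diff_matrix \<alpha> \<beta>"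
  assumes trop: "v \<in> trop I"
    and generic: "\<forall>i. card (Poly_Mapping.keys (initial_form v (equilibrium_poly c i))) = 2"
    and exponents: "\<forall>i. Poly_Mapping.keys (initial_form v (equilibrium_poly c i)) = {\<alpha> i, \<beta> i}"
    and unimodular: "\<forall>C \<in> pre_digraph.sccs_verts (exponent_diff_graph A). unimodular_block A C"
  shows "(\<exists>p. torus_zeros J = {p}) \<and>
         (\<exists>l. \<forall>x \<in> torus_zeros I. val_vec x = v \<longrightarrow> lc_vec x = l)"
proof -
  have "\<alpha> i \<noteq> \<beta> i" for i
    using generic exponents by (metis card_2_iff doubleton_eq_iff insert_absorb2)
  then obtain p where p: "torus_zeros J = {p}"
    using torus_zeros_binomials_singleton[of "\<lambda>i. initial_form v (equilibrium_poly c i)" \<alpha> \<beta>]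
      exponents unimodular
    unfolding J_def A_def torus_zeros_ideal_gen by blast
  have "lc_vec x \<in> torus_zeros J" if "x \<in> torus_zeros I" "val_vec x = v" for x
    using that meval_initial_form_lc_vec[of _ x v]
    unfolding I_def J_def equilibrium_ideal_def torus_zeros_ideal_gen
    by (auto simp: torus_zeros_def lc_vec_def[of x])
  with p show ?thesis by blast
qed


end
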